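(* For $r\in\mathbb{Z}_{\geq 0}$ let $$\alpha(r)=\prod_{j\geq 1}(1+2^{-j})^{-1}\prod_{j=1}^{r}\frac{2}{2^j-1}.$$ For $n\in\mathbb{Z}_{\geq 1}$, let $m\in\{0,1\}$ be such that $m\equiv n+1\pmod 2$, and let $$\beta_n=\sum_{r\geq 0}\frac{\alpha(2r+m)}{2^{n+2r+m}-1}.$$ Then $\beta_1=1/2$, and for all $n\in\mathbb{Z}_{\geq 2}$ we have $$\beta_n=2^{-n}\cdot\left(1-(2^{n-1}-1)\beta_{n-1}\right).$$ *)

theory Defs
  imports "HOL-Analysis.Analysis"
begin

text \<open>The infinite product runs over indices starting from 1, hence the shift \<open>Suc j\<close>.\<close>

definition alpha :: "nat \<Rightarrow> real" where
  "alpha r = (\<Prod>j. inverse (1 + 1 / 2 ^ Suc j)) * (\<Prod>j=1..r. 2 / (2 ^ j - 1))"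

definition beta :: "nat \<Rightarrow> real" where
  "beta n = (let m = (n + 1) mod 2 in \<Sum>r. alpha (2 * r + m) / (2 ^ (n + 2 * r + m) - 1))"

text \<open>
  Both \<^const>\<open>prodinf\<close> and \<^const>\<open>suminf\<close> are total; the next two lemmas show that the
  product and the series really converge, so that the definitions have their intended meaning.
\<close>

lemma convergent_prod_alpha: "convergent_prod (\<lambda>j. inverse (1 + 1 / 2 ^ Suc j :: real))"
proof -
  have "summable (\<lambda>j. (1 / 2) * (1 / 2) ^ j :: real)"
    by (intro summable_mult summable_geometric) simp
  then have "summable (\<lambda>j. 1 / 2 ^ Suc j :: real)"
    by (simp add: power_one_over)
  then have "summable (\<lambda>j. \<bar>1 / 2 ^ Suc j :: real\<bar>)"
    by simp
  moreover have "1 / 2 ^ Suc j \<noteq> (-1 :: real)" for j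
  proof -
    have "0 < (1 / 2 ^ Suc j :: real)"
      by simp
    then show ?thesis
      by linarith
  qed
  ultimately have "convergent_prod (\<lambda>j. 1 + 1 / 2 ^ Suc j :: real)"
    by (rule summable_imp_convergent_prod_real)
  then show ?thesis
    by (rule convergent_prod_inverse)
qed

lemma summable_beta:
  assumes "n \<ge> 1"
  shows "summable (\<lambda>r. alpha (2 * r + m) / (2 ^ (n + 2 * r + m) - 1))"
proof -
  define C :: real where "C = (\<Prod>j. inverse (1 + 1 / 2 ^ Suc j))"
  define P :: "nat \<Rightarrow> real" where "P r = (\<Prod>j=1..r. 2 / (2 ^ j - 1))" for r
  have P: "0 \<le> P r \<and> P r \<le> 2" for r
  proof (induction r)
    case (Suc r)
    show ?case
    proof (cases "r = 0")
      case False
      have "(2::real) ^ 2 \<le> 2 ^ Suc r"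
        using False by (intro power_increasing) auto
      then have "0 \<le> 2 / (2 ^ Suc r - 1 :: real)" "2 / (2 ^ Suc r - 1 :: real) \<le> 1"
        by (simp_all add: divide_simps)
      moreover have "P (Suc r) = P r * (2 / (2 ^ Suc r - 1))"
        by (simp add: P_def)
      ultimately show ?thesis
        using Suc mult_mono[of "P r" 2 "2 / (2 ^ Suc r - 1)" 1] by (simp del: power_Suc)
    qed (simp add: P_def)
  qed (simp add: P_def)
  have bound: "norm (alpha (2 * r + m) / (2 ^ (n + 2 * r + m) - 1)) \<le> 2 * \<bar>C\<bar> * (1 / 2) ^ r" for r
  proof -
    have "(2::real) ^ Suc r \<le> 2 ^ (n + 2 * r + m)"
      using assms by (intro power_increasing) auto
    moreover have "(1::real) \<le> 2 ^ r"
      by simp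
    ultimately have D: "(2::real) ^ r \<le> 2 ^ (n + 2 * r + m) - 1"
      unfolding power_Suc by linarith
    have "alpha (2 * r + m) = C * P (2 * r + m)"
      unfolding alpha_def C_def P_def ..
    then have "\<bar>alpha (2 * r + m)\<bar> \<le> 2 * \<bar>C\<bar>"
      using P[of "2 * r + m"] mult_left_mono[of "P (2 * r + m)" 2 "\<bar>C\<bar>"]
      by (simp add: abs_mult mult.commute)
    then have "\<bar>alpha (2 * r + m)\<bar> / (2 ^ (n + 2 * r + m) - 1) \<le> 2 * \<bar>C\<bar> / 2 ^ r"
      using D by (intro frac_le) auto
    moreover have "(0::real) < 2 ^ r" by simp
    then have "\<bar>2 ^ (n + 2 * r + m) - 1 :: real\<bar> = 2 ^ (n + 2 * r + m) - 1"
      using D by linarith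
    ultimately show ?thesis
      by (simp add: power_one_over)
  qed
  have "summable (\<lambda>r. 2 * \<bar>C\<bar> * (1 / 2) ^ r)"
    by (intro summable_mult summable_geometric) simp
  then show ?thesis
    by (rule summable_comparison_test') (rule bound)
qed

end

theory Submission
  imports Defs
begin

text \<open>
  The recursion \<open>(2 ^ (r + 1) - 1) \<alpha>(r + 1) = 2 \<alpha>(r)\<close> makes the \<open>r\<close>-th term of \<open>2 ^ n \<beta>\<^sub>n\<close> and the
  term with index \<open>r + 1\<close> of \<open>(2 ^ (n - 1) - 1) \<beta>\<^bsub>n-1\<^esub>\<close>, which have the same denominator, add up
  to \<open>\<alpha>(r + 1)\<close>. Hence \<open>2 ^ n \<beta>\<^sub>n + (2 ^ (n - 1) - 1) \<beta>\<^bsub>n-1\<^esub>\<close> is the sum of \<open>\<alpha>\<close> over all indices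
  of the parity of \<open>n\<close>. Both these sums are 1: by the same recursion \<open>G(x) = \<Sum>r. \<alpha>(r) x ^ r\<close>
  satisfies \<open>G(2 x) = (1 + 2 x) G(x)\<close>, so that \<open>G(-1) = 0\<close>, and iterating towards 0 gives \<open>G(1) = 2\<close>.
\<close>

lemma alpha_0: "alpha 0 = (\<Prod>j. inverse (1 + 1 / 2 ^ Suc j))"
  by (simp add: alpha_def)

lemma alpha_Suc: "alpha (Suc r) = alpha r * (2 / (2 ^ Suc r - 1))"
  by (simp add: alpha_def)

lemma two_power_neq_1: "n > 0 \<Longrightarrow> (2::real) ^ n \<noteq> 1"
  by (rule less_imp_neq[THEN not_sym], rule one_less_power) auto

lemma two_power_alpha_Suc: "2 ^ Suc r * alpha (Suc r) = alpha (Suc r) + 2 * alpha r"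
proof -
  have "(2::real) ^ Suc r \<noteq> 1"
    by (rule two_power_neq_1) simp
  then show ?thesis
    by (simp add: alpha_Suc field_simps)
qed

lemma alpha_0_nonzero: "alpha 0 \<noteq> 0"
proof -
  have "(1 + 1 / 2 ^ Suc j :: real) > 0" for j
    by (simp add: add_pos_pos)
  then show ?thesis
    unfolding alpha_0
    by (intro prodinf_nonzero convergent_prod_alpha) (metis inverse_nonzero_iff_nonzero less_irrefl)
qed

text \<open>Consecutive terms have ratio \<open>2 * x / (2 ^ Suc r - 1)\<close>, which tends to 0,
  so the series converges for every real \<open>x\<close>.\<close>

lemma summable_alpha_power:
  fixes x :: real
  shows "summable (\<lambda>r. alpha r * x ^ r)"
proof -
  \<comment> \<open>This bound on \<open>N\<close> makes the ratio at most 1/2 in absolute value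
    from index \<open>N\<close> on.\<close>
  obtain N where N: "4 * \<bar>x\<bar> + 1 < (2::real) ^ N"
    using real_arch_pow[of 2] by auto
  have "norm (alpha (Suc r) * x ^ Suc r) \<le> 1 / 2 * norm (alpha r * x ^ r)" if "r \<ge> N" for r
  proof -
    have "(2::real) ^ N \<le> 2 ^ Suc r"
      using that by (intro power_increasing) auto
    then have "4 * \<bar>x\<bar> < 2 ^ Suc r - 1"
      using N by linarith
    then have "\<bar>2 / (2 ^ Suc r - 1) * x\<bar> \<le> 1 / 2"
      by (simp add: abs_mult divide_simps del: power_Suc)
    then have "\<bar>2 / (2 ^ Suc r - 1) * x\<bar> * \<bar>alpha r * x ^ r\<bar> \<le> 1 / 2 * \<bar>alpha r * x ^ r\<bar>"
      by (rule mult_right_mono) simp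
    moreover have "alpha (Suc r) * x ^ Suc r = 2 / (2 ^ Suc r - 1) * x * (alpha r * x ^ r)"
      by (simp add: alpha_Suc)
    ultimately show ?thesis
      by (simp only: abs_mult real_norm_def)
  qed
  then show ?thesis
    by (intro summable_ratio_test[where c = "1 / 2" and N = N]) auto
qed

definition alpha_gf :: "real \<Rightarrow> real" where
  "alpha_gf x = (\<Sum>r. alpha r * x ^ r)"

lemma alpha_gf_sums: "(\<lambda>r. alpha r * x ^ r) sums alpha_gf x"
  unfolding alpha_gf_def by (rule summable_sums[OF summable_alpha_power])

text \<open>Coefficientwise this is \<open>two_power_alpha_Suc\<close>; the constant terms
  agree.\<close>

lemma alpha_gf_double: "alpha_gf (2 * x) = (1 + 2 * x) * alpha_gf x"
proof -
  have shift: "(\<lambda>r. alpha (Suc r) * y ^ Suc r) sums (alpha_gf y - alpha 0)" for y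
    using alpha_gf_sums[of y] by (subst sums_Suc_iff) simp
  have "(\<lambda>r. alpha (Suc r) * x ^ Suc r + 2 * x * (alpha r * x ^ r))
      sums (alpha_gf x - alpha 0 + 2 * x * alpha_gf x)"
    by (intro sums_add sums_mult shift alpha_gf_sums)
  moreover have "alpha (Suc r) * x ^ Suc r + 2 * x * (alpha r * x ^ r)
      = alpha (Suc r) * (2 * x) ^ Suc r" for r
  proof -
    have "alpha (Suc r) * (2 * x) ^ Suc r = (2 ^ Suc r * alpha (Suc r)) * x ^ Suc r"
      by (simp only: power_mult_distrib mult_ac)
    then show ?thesis
      unfolding two_power_alpha_Suc by (simp add: algebra_simps)
  qed
  ultimately have "(\<lambda>r. alpha (Suc r) * (2 * x) ^ Suc r)
      sums (alpha_gf x - alpha 0 + 2 * x * alpha_gf x)"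
    by (simp only:)
  from sums_unique2[OF this shift] show ?thesis
    by (simp add: algebra_simps)
qed

lemma alpha_gf_0: "alpha_gf 0 = alpha 0"
  unfolding alpha_gf_def by (rule powser_zero)

text \<open>At \<open>x = -1/2\<close> the factor \<open>1 + 2 * x\<close> vanishes.\<close>

lemma alpha_gf_minus_1: "alpha_gf (-1) = 0"
  using alpha_gf_double[of "-1/2"] by simp

lemma isCont_alpha_gf: "isCont alpha_gf 0"
proof -
  have "isCont (\<lambda>x. \<Sum>r. alpha r * x ^ r) 0"
    by (rule isCont_powser[OF summable_alpha_power[of 1]]) simp
  then show ?thesis
    by (simp add: alpha_gf_def[abs_def])
qed

lemma alpha_gf_1: "alpha_gf 1 = 2"
proof -
  \<comment> \<open>Starting at 1/2 rather than 1 makes the accumulated factors exactly the partial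
    products of \<open>alpha 0\<close>, so that \<open>alpha 0\<close> cancels in the limit.\<close>
  have iter: "alpha_gf (1 / 2 ^ Suc N) = alpha_gf (1 / 2) * (\<Prod>j<N. inverse (1 + 1 / 2 ^ Suc j))" for N
  proof (induction N)
    case (Suc N)
    have "1 + 1 / 2 ^ Suc N > (0::real)"
      by (simp add: add_pos_pos)
    then have "alpha_gf (1 / 2 ^ Suc (Suc N)) = alpha_gf (1 / 2 ^ Suc N) * inverse (1 + 1 / 2 ^ Suc N)"
      using alpha_gf_double[of "1 / 2 ^ Suc (Suc N)"] by (simp add: field_simps)
    then show ?case
      by (simp only: Suc.IH prod.lessThan_Suc mult.assoc)
  qed simp
  have "(\<lambda>N. (1 / 2 :: real) ^ Suc N) \<longlonglongrightarrow> 0"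
    by (intro LIMSEQ_Suc LIMSEQ_realpow_zero) auto
  then have "(\<lambda>N. alpha_gf (1 / 2 ^ Suc N)) \<longlonglongrightarrow> alpha 0"
    using isCont_tendsto_compose[OF isCont_alpha_gf] by (simp add: alpha_gf_0 power_one_over)
  moreover have "(\<lambda>N. \<Prod>j\<le>N. inverse (1 + 1 / 2 ^ Suc j :: real)) \<longlonglongrightarrow> alpha 0"
    unfolding alpha_0 by (rule convergent_prod_LIMSEQ[OF convergent_prod_alpha])
  then have "(\<lambda>N. \<Prod>j<N. inverse (1 + 1 / 2 ^ Suc j :: real)) \<longlonglongrightarrow> alpha 0"
    by (subst (asm) lessThan_Suc_atMost[symmetric]) (rule LIMSEQ_imp_Suc)
  then have "(\<lambda>N. alpha_gf (1 / 2 ^ Suc N)) \<longlonglongrightarrow> alpha_gf (1 / 2) * alpha 0"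
    unfolding iter by (rule tendsto_mult_left)
  ultimately have "alpha_gf (1 / 2) * alpha 0 = alpha 0"
    using LIMSEQ_unique by blast
  then have "alpha_gf (1 / 2) = 1"
    using alpha_0_nonzero by simp
  then show ?thesis
    using alpha_gf_double[of "1 / 2"] by simp
qed

text \<open>Half the sum and half the difference of the series at 1 and -1 keep only the even and
  only the odd indices.\<close>

lemma alpha_parity_sums: "(\<lambda>r. alpha (2 * r)) sums 1" "(\<lambda>r. alpha (2 * r + 1)) sums 1"
proof -
  have pair: "sum f {r * 2..<r * 2 + 2} = f (2 * r) + f (2 * r + 1)" for f :: "nat \<Rightarrow> real" and r
    by (simp add: numeral_2_eq_2 mult.commute)
  have s: "alpha sums 2" "(\<lambda>r. alpha r * (-1) ^ r) sums 0"
    using alpha_gf_sums[of 1] alpha_gf_sums[of "-1"] by (simp_all add: alpha_gf_1 alpha_gf_minus_1)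
  have "(\<lambda>r. (alpha r + alpha r * (-1) ^ r) / 2) sums ((2 + 0) / 2)"
    "(\<lambda>r. (alpha r - alpha r * (-1) ^ r) / 2) sums ((2 - 0) / 2)"
    by (intro sums_divide sums_add sums_diff s)+
  \<comment> \<open>Each block of two consecutive indices contains one surviving term and one
    zero.\<close>
  from this[THEN sums_group[where k = 2]]
  show "(\<lambda>r. alpha (2 * r)) sums 1" "(\<lambda>r. alpha (2 * r + 1)) sums 1"
    by (simp_all add: pair mult.commute)
qed

lemma beta_terms_add:
  assumes "n \<ge> 1"
  shows "2 ^ n * (alpha r / (2 ^ (n + r) - 1)) +
    (2 ^ (n - 1) - 1) * (alpha (Suc r) / (2 ^ (n + r) - 1)) = alpha (Suc r)"
proof -
  have "(2::real) ^ (n + r) \<noteq> 1"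
    using assms by (intro two_power_neq_1) simp
  moreover have "2 ^ n * alpha r + (2 ^ (n - 1) - 1) * alpha (Suc r)
      = (2 ^ (n + r) - 1) * alpha (Suc r)"
  proof -
    obtain k where n: "n = Suc k"
      using assms by (cases n) auto
    \<comment> \<open>The claim is the recursion for \<open>alpha\<close> multiplied by
      \<open>2 ^ (n - 1)\<close>.\<close>
    have "2 ^ k * (2 ^ Suc r * alpha (Suc r)) = 2 ^ k * (alpha (Suc r) + 2 * alpha r)"
      unfolding two_power_alpha_Suc ..
    then show ?thesis
      by (simp add: n power_add algebra_simps)
  qed
  ultimately show ?thesis
    by (simp add: times_divide_eq_right add_divide_distrib[symmetric] del: power_add)
qed

lemma beta_recurrence:
  assumes "n \<ge> 2"
  shows "2 ^ n * beta n + (2 ^ (n - 1) - 1) * beta (n - 1) = 1"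
proof -
  define f where "f n m r = alpha (2 * r + m) / (2 ^ (n + 2 * r + m) - 1)" for n m r :: nat
  have f: "f n m sums suminf (f n m)" if "n \<ge> 1" for n m
    unfolding f_def by (intro summable_sums summable_beta that)
  have beta: "beta n = suminf (f n ((n + 1) mod 2))" for n
    by (simp add: beta_def Let_def f_def[abs_def])
  show ?thesis
  proof (cases "even n")
    case False
    then have b: "beta n = suminf (f n 0)" "beta (n - 1) = suminf (f (n - 1) 1)"
      using assms by (auto simp: beta elim!: oddE)
    have "(\<lambda>r. 2 ^ n * f n 0 r + (2 ^ (n - 1) - 1) * f (n - 1) 1 r)
        sums (2 ^ n * beta n + (2 ^ (n - 1) - 1) * beta (n - 1))"
      unfolding b using assms by (intro sums_add sums_mult f) auto
    moreover have "2 ^ n * f n 0 r + (2 ^ (n - 1) - 1) * f (n - 1) 1 r = alpha (2 * r + 1)" for r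
      using beta_terms_add[of n "2 * r"] assms by (simp add: f_def)
    ultimately show ?thesis
      using sums_unique2[OF alpha_parity_sums(2)] by simp
  next
    case True
    then have b: "beta n = suminf (f n 1)" "beta (n - 1) = suminf (f (n - 1) 0)"
      using assms by (auto simp: beta mod_Suc elim!: evenE)
    \<comment> \<open>For even \<open>n\<close>, the index \<open>2 * r + 1\<close> is paired with
      \<open>2 * Suc r\<close>. The first term of \<open>beta (n - 1)\<close> stays unpaired; its
      weighted value is \<open>alpha 0\<close>, just what the shifted sum over even indices
      lacks.\<close>
    have "(\<lambda>r. f (n - 1) 0 (Suc r)) sums (beta (n - 1) - f (n - 1) 0 0)"
      unfolding b using assms f[of "n - 1" 0] by (subst sums_Suc_iff) simp
    then have "(\<lambda>r. 2 ^ n * f n 1 r + (2 ^ (n - 1) - 1) * f (n - 1) 0 (Suc r))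
        sums (2 ^ n * beta n + (2 ^ (n - 1) - 1) * (beta (n - 1) - f (n - 1) 0 0))"
      unfolding b(1) using assms by (intro sums_add sums_mult f) auto
    moreover have "2 ^ n * f n 1 r + (2 ^ (n - 1) - 1) * f (n - 1) 0 (Suc r)
        = alpha (2 * Suc r)" for r
      using beta_terms_add[of n "2 * r + 1"] assms by (cases n) (simp_all add: f_def)
    moreover have "(\<lambda>r. alpha (2 * Suc r)) sums (1 - alpha 0)"
      using alpha_parity_sums(1) by (subst sums_Suc_iff) simp
    moreover have "(2 ^ (n - 1) - 1) * f (n - 1) 0 0 = alpha 0"
      using two_power_neq_1[of "n - 1"] assms by (simp add: f_def)
    ultimately show ?thesis
      using sums_unique2 by (fastforce simp: algebra_simps)
  qed
qed

text \<open>For \<open>n = 1\<close> the coefficient \<open>2 ^ (n - 1) - 1\<close> in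
  \<open>beta_terms_add\<close> is 0, so each term of \<open>beta 1\<close> is half of an
  \<open>alpha\<close> with odd index.\<close>

lemma beta_1: "beta 1 = 1 / 2"
proof -
  have "alpha (2 * r) / (2 ^ (1 + 2 * r) - 1) = alpha (2 * r + 1) / 2" for r
    using beta_terms_add[of 1 "2 * r"] by (simp add: mult.commute)
  moreover have "beta 1 = (\<Sum>r. alpha (2 * r) / (2 ^ (1 + 2 * r) - 1))"
    by (simp add: beta_def)
  ultimately have "beta 1 = (\<Sum>r. alpha (2 * r + 1) / 2)"
    by (simp only:)
  then show ?thesis
    using sums_unique[OF sums_divide[OF alpha_parity_sums(2), of 2]] by simp
qed

theorem proposition1p10:
  shows "beta 1 = 1 / 2 \<and>
    (\<forall>n\<ge>2. beta n = 1 / 2 ^ n * (1 - (2 ^ (n - 1) - 1) * beta (n - 1)))"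
proof (intro conjI allI impI)
  fix n :: nat
  assume "n \<ge> 2"
  from beta_recurrence[OF this]
  show "beta n = 1 / 2 ^ n * (1 - (2 ^ (n - 1) - 1) * beta (n - 1))"
    by (simp add: field_simps)
qed (rule beta_1)

end
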